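(* For any integer $s\geq 6$, we have $r'_2(s)\leq \left\lceil\frac{13}{48}2^s\right\rceil$.
   Context: All graphs are finite and simple. A threshold graph of order $s$ is an $s$-vertex graph that can be constructed from the one-vertex graph by repeatedly adding a new vertex that is either adjacent to all the previous vertices or nonadjacent to all the previous vertices. For a positive integer $s$, $r'_2(s)$ is the minimum integer $n$ such that every $n$-vertex graph contains a threshold graph of order $s$ as an induced subgraph. *)

theory Defs
  imports Complex_Main "Graph_Theory.Digraph_Component"
begin

text \<open>
  Finite simple graphs are rendered by \<^locale>\<open>pair_graph\<close>: a finite vertex set with a finite,
  irreflexive, symmetric set of arcs, each edge being represented by both of its orientations.
\<close>

inductive threshold_graph :: "'a pair_pre_digraph \<Rightarrow> bool" where
  single: "threshold_graph \<lparr>pverts = {v}, parcs = {}\<rparr>"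
| isolated: "\<lbrakk>threshold_graph G; v \<notin> pverts G\<rbrakk> \<Longrightarrow>
    threshold_graph \<lparr>pverts = insert v (pverts G), parcs = parcs G\<rparr>"
| dominating: "\<lbrakk>threshold_graph G; v \<notin> pverts G\<rbrakk> \<Longrightarrow>
    threshold_graph \<lparr>pverts = insert v (pverts G),
      parcs = parcs G \<union> {v} \<times> pverts G \<union> pverts G \<times> {v}\<rparr>"

lemma threshold_graph_pair_graph:
  assumes "threshold_graph G"
  shows "pair_graph G" and "pverts G \<noteq> {}"
proof -
  have "finite (pverts G) \<and> pverts G \<noteq> {} \<and> finite (parcs G) \<and> sym (parcs G) \<and>
      parcs G \<subseteq> pverts G \<times> pverts G \<and> (\<forall>e\<in>parcs G. fst e \<noteq> snd e)"
    using assms by induction (auto simp: sym_def)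
  then show "pair_graph G" and "pverts G \<noteq> {}"
    by - (unfold_locales, auto simp: symmetric_def)
qed

text \<open>
  The vertices of the induced copy are those of the host graph. No isomorphism is needed, since
  threshold graphs are defined on arbitrary vertices and hence closed under renaming.
\<close>

definition has_induced_threshold :: "nat \<Rightarrow> 'a pair_pre_digraph \<Rightarrow> bool" where
  "has_induced_threshold s G \<longleftrightarrow>
    (\<exists>H. induced_subgraph (with_proj H) (with_proj G) \<and> threshold_graph H \<and> card (pverts H) = s)"

text \<open>
  Every finite graph is isomorphic to one whose vertices are natural numbers, so taking
  \<^typ>\<open>nat\<close> as the vertex type loses no generality.
\<close>

definition r2' :: "nat \<Rightarrow> nat" where
  "r2' s = (LEAST n. \<forall>G :: nat pair_pre_digraph.
     pair_graph G \<and> card (pverts G) = n \<longrightarrow> has_induced_threshold s G)"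

lemma threshold_in_large_set:
  assumes "sym E" "irrefl E" "finite V" "2 ^ s \<le> card V"
  shows "\<exists>W\<subseteq>V. card W = Suc s \<and> threshold_graph \<lparr>pverts = W, parcs = E \<inter> W \<times> W\<rparr>"
  using assms(3,4)
proof (induction s arbitrary: V)
  case 0
  then obtain v where v: "v \<in> V"
    by fastforce
  have "E \<inter> {v} \<times> {v} = {}"
    using \<open>irrefl E\<close> by (auto simp: irrefl_def)
  then show ?case
    using v threshold_graph.single[of v] by (intro exI[of _ "{v}"]) auto
next
  case (Suc s)
  then obtain v where v: "v \<in> V"
    by fastforce
  let ?A = "{u \<in> V - {v}. (v, u) \<in> E}" and ?B = "{u \<in> V - {v}. (v, u) \<notin> E}"
  have "card (V - {v}) = card (?A \<union> ?B)"
    by (rule arg_cong[of _ _ card]) auto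
  also have "\<dots> = card ?A + card ?B"
    using Suc.prems(1) by (intro card_Un_disjoint) auto
  finally have "card V \<le> Suc (card ?A + card ?B)"
    using v Suc.prems(1) by simp
  then have "2 * 2 ^ s \<le> Suc (card ?A + card ?B)"
    using Suc.prems(2) by simp
  then consider "2 ^ s \<le> card ?A" | "2 ^ s \<le> card ?B"
    by linarith
  then show ?case
  proof cases
    case 1
    then obtain W where W: "W \<subseteq> ?A" "card W = Suc s"
        "threshold_graph \<lparr>pverts = W, parcs = E \<inter> W \<times> W\<rparr>"
      using Suc.IH[of ?A] Suc.prems(1) by auto
    have fin: "finite W"
      using W(2) by (metis card.infinite nat.distinct(1))
    have "v \<notin> W"
      using W(1) by auto
    moreover have "E \<inter> insert v W \<times> insert v W = E \<inter> W \<times> W \<union> {v} \<times> W \<union> W \<times> {v}"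
      using W(1) \<open>sym E\<close> \<open>irrefl E\<close> by (auto simp: sym_def irrefl_def)
    ultimately show ?thesis
      using W v fin threshold_graph.dominating[OF W(3), of v]
      by (intro exI[of _ "insert v W"]) auto
  next
    case 2
    then obtain W where W: "W \<subseteq> ?B" "card W = Suc s"
        "threshold_graph \<lparr>pverts = W, parcs = E \<inter> W \<times> W\<rparr>"
      using Suc.IH[of ?B] Suc.prems(1) by auto
    have fin: "finite W"
      using W(2) by (metis card.infinite nat.distinct(1))
    have "v \<notin> W"
      using W(1) by auto
    moreover have "E \<inter> insert v W \<times> insert v W = E \<inter> W \<times> W"
      using W(1) \<open>sym E\<close> \<open>irrefl E\<close> by (auto simp: sym_def irrefl_def)
    ultimately show ?thesis
      using W v fin threshold_graph.isolated[OF W(3), of v]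
      by (intro exI[of _ "insert v W"]) auto
  qed
qed

text \<open>The minimum defining \<^const>\<open>r2'\<close> is attained for positive arguments.\<close>

lemma r2'_attained:
  fixes G :: "nat pair_pre_digraph"
  assumes "1 \<le> s" "pair_graph G" "card (pverts G) = r2' s"
  shows "has_induced_threshold s G"
proof -
  obtain t where t: "s = Suc t"
    using assms(1) by (cases s) auto
  have "has_induced_threshold s G"
    if G: "pair_graph G" and card: "card (pverts G) = 2 ^ t" for G :: "nat pair_pre_digraph"
  proof -
    interpret pair_graph G by fact
    have "sym (parcs G)"
      using pair_sym_arcs by (simp add: symmetric_def)
    moreover have "irrefl (parcs G)"
      by (fastforce simp: irrefl_def dest: pair_no_loops)
    ultimately obtain W where W: "W \<subseteq> pverts G" "card W = s"
        "threshold_graph \<lparr>pverts = W, parcs = parcs G \<inter> W \<times> W\<rparr>"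
      using threshold_in_large_set[of "parcs G" "pverts G" t] card t pair_finite_verts by auto
    let ?H = "\<lparr>pverts = W, parcs = parcs G \<inter> W \<times> W\<rparr>"
    have "pair_graph ?H"
      using threshold_graph_pair_graph(1)[OF W(3)] .
    then have "wf_digraph (with_proj ?H)"
      unfolding wf_digraph_wp_iff pair_graph_def pair_digraph_def pair_fin_digraph_def by blast
    then have "induced_subgraph (with_proj ?H) (with_proj G)"
      using W(1) wf_digraph
      by (auto simp: induced_subgraph_def subgraph_def compatible_def)
    then show ?thesis
      using W unfolding has_induced_threshold_def by auto
  qed
  then have "\<exists>n. \<forall>G :: nat pair_pre_digraph.
      pair_graph G \<and> card (pverts G) = n \<longrightarrow> has_induced_threshold s G"
    by blast
  from LeastI_ex[OF this] show ?thesis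
    using assms(2,3) unfolding r2'_def by blast
qed

end

theory Submission
  imports Defs
begin

text \<open>
  Splitting at a vertex, one of its two sides (neighbours or non-neighbours) contains at least half
  of the remaining vertices, so a bound \<open>n\<close> for \<open>s\<close> gives the bound \<open>2 n\<close> for \<open>s + 1\<close>. If \<open>n\<close> is even,
  \<open>2 n - 1\<close> suffices: otherwise the graph would be regular of odd degree \<open>n - 1\<close> on an odd number of
  vertices. Starting from the bound 18 for \<open>s = 6\<close>, this doubling produces exactly
  \<open>\<lceil>13/48 * 2 ^ s\<rceil>\<close>.

  For 18 vertices, suppose that there is no threshold graph of order 6. The two sides of every vertex
  have 8 and 9 vertices and contain no threshold graph of order 5. On the side with 9 vertices this
  forces the parameters (9, 4, 1, 2) of the Paley graph; on the side with 8 vertices it forces at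
  least 10 edges. Double counting the edges between vertices of degree 9 and of degree 8 shows that
  these bounds are tight and then that the graph is regular, of degree 9 up to complement. Tightness
  also produces nonadjacent \<open>v\<close>, \<open>x\<close> with 5 common neighbours. These induce a pentagon in the
  neighbourhood of \<open>v\<close>, which the parameters (9, 4, 1, 2) exclude.
\<close>

section \<open>Neighbourhoods and the arithmetic of the bound\<close>

definition compl_rel :: "('a \<Rightarrow> 'a \<Rightarrow> bool) \<Rightarrow> 'a \<Rightarrow> 'a \<Rightarrow> bool" where
  "compl_rel E u v \<longleftrightarrow> u \<noteq> v \<and> \<not> E u v"

definition nbh :: "('a \<Rightarrow> 'a \<Rightarrow> bool) \<Rightarrow> 'a \<Rightarrow> 'a set \<Rightarrow> 'a set" where
  "nbh E v S = {u \<in> S. E v u}"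

text \<open>Threshold subgraphs as a Ramsey recursion that is symmetric under complementation.\<close>

fun thr :: "('a \<Rightarrow> 'a \<Rightarrow> bool) \<Rightarrow> nat \<Rightarrow> 'a set \<Rightarrow> bool" where
  "thr E 0 S \<longleftrightarrow> True"
| "thr E (Suc s) S \<longleftrightarrow> (\<exists>v\<in>S. thr E s (nbh E v S) \<or> thr E s (nbh (compl_rel E) v S))"

lemma nbh_subset: "nbh E v S \<subseteq> S"
  and nbh_mono: "S \<subseteq> T \<Longrightarrow> nbh E v S \<subseteq> nbh E v T"
  and in_nbh_iff: "u \<in> nbh E v S \<longleftrightarrow> u \<in> S \<and> E v u"
  and nbh_Un: "nbh E v (S \<union> T) = nbh E v S \<union> nbh E v T"
  by (auto simp: nbh_def)

lemma finite_nbh [simp]: "finite S \<Longrightarrow> finite (nbh E v S)"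
  by (auto simp: nbh_def)

lemma thr_mono: "thr E k S \<Longrightarrow> S \<subseteq> T \<Longrightarrow> thr E k T"
proof (induction k arbitrary: S T)
  case (Suc k)
  then show ?case
    by simp (meson nbh_mono subsetD)
qed simp

lemma card_nbh_split:
  assumes "finite S" "A \<union> B = S" "A \<inter> B = {}"
  shows "card (nbh E v S) = card (nbh E v A) + card (nbh E v B)"
proof -
  have "finite A" "finite B" using assms by auto
  moreover have "nbh E v A \<inter> nbh E v B = {}"
    using assms by (auto simp: nbh_def)
  ultimately show ?thesis
    unfolding assms(2)[symmetric] nbh_Un by (simp add: card_Un_disjoint)
qed

lemma card_nbh_insert:
  assumes "finite S" "x \<notin> S"
  shows "card (nbh E v (insert x S)) = of_bool (E v x) + card (nbh E v S)"
proof -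
  have "nbh E v (insert x S) = (if E v x then insert x (nbh E v S) else nbh E v S)"
    by (auto simp: nbh_def)
  then show ?thesis using assms by (auto simp: in_nbh_iff)
qed

lemma sum_of_bool_subset:
  assumes "finite M" "A \<subseteq> M"
  shows "(\<Sum>c\<in>M. of_bool (c \<in> A)) = card A"
  using assms by (simp add: Int_absorb1)

text \<open>Since \<open>13 * 2 ^ (s + 2) / 3\<close> equals \<open>13 / 48 * 2 ^ (s + 6)\<close>,
  the added 2 or 1 rounds it up: the quotient by 3 is the ceiling claimed for order
  \<open>s + 6\<close>.\<close>

lemma three_dvd_bound: "3 dvd 13 * 2 ^ (s + 2) + (if even s then 2 else 1 :: nat)"
proof (induction s)
  case (Suc s)
  have "3 dvd m + 2 \<Longrightarrow> 3 dvd 2 * m + 1" "3 dvd m + 1 \<Longrightarrow> 3 dvd 2 * m + 2" for m :: nat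
    by presburger+
  from this[of "13 * 2 ^ (s + 2)"] Suc show ?case
    by (cases "even s") simp_all
qed simp

section \<open>Graphs as relations: complement and counting\<close>

text \<open>The relation carries no vertex set: the recursion keeps passing to subsets under a fixed
  relation, and the complement is again an instance of the locale.\<close>

locale graph_rel =
  fixes E :: "'a \<Rightarrow> 'a \<Rightarrow> bool"
  assumes sym: "E u v \<Longrightarrow> E v u" and irrefl: "\<not> E v v"
begin

lemma compl_graph_rel: "graph_rel (compl_rel E)"
  by unfold_locales (auto simp: compl_rel_def dest: sym)

lemma compl_compl [simp]: "compl_rel (compl_rel E) = E"
  using irrefl by (auto simp: compl_rel_def fun_eq_iff)

text \<open>Complementation only swaps the two disjuncts of the recursion. With
  \<open>compl_graph_rel\<close>, it transfers every later result to the complement.\<close>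

lemma thr_compl: "thr (compl_rel E) k S \<longleftrightarrow> thr E k S"
  by (induction k arbitrary: S) auto

lemma nbh_decomp:
  assumes "v \<in> S"
  shows "S = insert v (nbh E v S \<union> nbh (compl_rel E) v S)"
    "v \<notin> nbh E v S \<union> nbh (compl_rel E) v S"
    "nbh E v S \<inter> nbh (compl_rel E) v S = {}"
  using assms irrefl by (auto simp: in_nbh_iff compl_rel_def)

lemma card_nbh_compl:
  assumes "finite S" "v \<in> S"
  shows "card (nbh E v S) + card (nbh (compl_rel E) v S) + 1 = card S"
  using nbh_decomp[OF assms(2)] assms(1)
  by (metis (no_types, lifting) Suc_eq_plus1 card_Un_disjoint card_insert_disjoint finite_UnI finite_nbh)

text \<open>With the degree of \<open>u\<close> and its degree inside one side of \<open>v\<close>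
  known, this yields the number of its edges to the other side.\<close>

lemma card_nbh_decomp:
  assumes "finite S" "v \<in> S"
  shows "card (nbh E u S)
    = of_bool (E u v) + (card (nbh E u (nbh E v S)) + card (nbh E u (nbh (compl_rel E) v S)))"
proof -
  note d = nbh_decomp[OF assms(2)]
  have "card (nbh E u S) = of_bool (E u v) + card (nbh E u (nbh E v S \<union> nbh (compl_rel E) v S))"
    by (subst d(1), rule card_nbh_insert) (use d assms in auto)
  also have "card (nbh E u (nbh E v S \<union> nbh (compl_rel E) v S))
      = card (nbh E u (nbh E v S)) + card (nbh E u (nbh (compl_rel E) v S))"
    by (rule card_nbh_split) (use d assms in auto)
  finally show ?thesis .
qed

lemma double_count:
  assumes "finite A" "finite B"
  shows "(\<Sum>a\<in>A. card (nbh E a B)) = (\<Sum>b\<in>B. card (nbh E b A))"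
proof -
  have "(\<Sum>a\<in>A. card (nbh E a B)) = (\<Sum>a\<in>A. \<Sum>b\<in>B. of_bool (E a b))"
    using assms by (intro sum.cong) (auto simp: nbh_def Int_def)
  also have "\<dots> = (\<Sum>b\<in>B. \<Sum>a\<in>A. of_bool (E b a))"
    by (subst sum.swap) (intro sum.cong refl arg_cong[of _ _ of_bool], use sym in blast)
  also have "\<dots> = (\<Sum>b\<in>B. card (nbh E b A))"
    using assms by (intro sum.cong) (auto simp: nbh_def Int_def)
  finally show ?thesis .
qed

text \<open>Handshake lemma: inserting \<open>x\<close> contributes its degree once at
  \<open>x\<close> and once spread over its neighbours.\<close>

lemma even_degree_sum:
  assumes "finite S"
  shows "even (\<Sum>v\<in>S. card (nbh E v S))"
  using assms
proof induction
  case (insert x F)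
  have "(\<Sum>v\<in>F. card (nbh E v (insert x F)))
      = (\<Sum>v\<in>F. of_bool (E v x)) + (\<Sum>v\<in>F. card (nbh E v F))"
    using insert by (simp add: card_nbh_insert sum.distrib)
  also have "(\<Sum>v\<in>F. of_bool (E v x)) = card (nbh E x F)"
    using insert sym by (auto simp: nbh_def Int_def intro!: arg_cong[of _ _ card])
  finally show ?case
    using insert irrefl by (simp add: card_nbh_insert)
qed simp

section \<open>Orders 3 and 4\<close>

text \<open>By parity the degrees in a triple are not all 1, so some vertex has the other two on the
  same side, and any two vertices give order 2.\<close>

lemma thr_3:
  assumes "finite S" "card S \<ge> 3"
  shows "thr E 3 S"
proof -
  have pair: "thr E 2 T" if T: "finite T" "card T \<ge> 2" for T
  proof -
    obtain v where v: "v \<in> T" using T(2) by fastforce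
    then have "nbh E v T \<noteq> {} \<or> nbh (compl_rel E) v T \<noteq> {}"
      using card_nbh_compl[OF T(1) v] T(2) by auto
    then show ?thesis using v by (auto simp: numeral_2_eq_2)
  qed
  obtain T where T: "T \<subseteq> S" "card T = 3" "finite T"
    using obtain_subset_with_card_n[OF assms(2)] by metis
  have "\<exists>v\<in>T. card (nbh E v T) \<noteq> 1"
  proof (rule ccontr)
    assume "\<not> ?thesis"
    then have "(\<Sum>v\<in>T. card (nbh E v T)) = 3" using T by simp
    then show False using even_degree_sum[OF T(3)] by simp
  qed
  then obtain v where v: "v \<in> T" "card (nbh E v T) \<noteq> 1" by blast
  then have "card (nbh E v T) \<ge> 2 \<or> card (nbh (compl_rel E) v T) \<ge> 2"
    using card_nbh_compl[OF T(3) v(1)] T(2) by linarith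
  then have "thr E 2 (nbh E v T) \<or> thr E 2 (nbh (compl_rel E) v T)"
    using pair finite_nbh[OF T(3)] by blast
  then have "thr E (Suc 2) T" using v(1) unfolding thr.simps by blast
  from thr_mono[OF this T(1)] show ?thesis by (simp del: thr.simps)
qed

lemma free_step:
  assumes "\<not> thr E n S" "v \<in> S" "n = Suc k"
  shows "\<not> thr E k (nbh E v S)" "\<not> thr E k (nbh (compl_rel E) v S)"
  using assms by auto

lemma free4_degree:
  assumes "finite S" "\<not> thr E 4 S" "v \<in> S"
  shows "card (nbh E v S) \<le> 2" "card (nbh (compl_rel E) v S) \<le> 2"
proof -
  have "\<not> thr E 3 (nbh E v S)" "\<not> thr E 3 (nbh (compl_rel E) v S)"
    using free_step[OF assms(2,3), of 3] by simp_all
  then have "\<not> 3 \<le> card (nbh E v S)" "\<not> 3 \<le> card (nbh (compl_rel E) v S)"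
    using thr_3 finite_nbh[OF assms(1)] by blast+
  then show "card (nbh E v S) \<le> 2" "card (nbh (compl_rel E) v S) \<le> 2" by linarith+
qed

lemma free4_card:
  assumes "finite S" "\<not> thr E 4 S"
  shows "card S \<le> 5"
proof (cases "S = {}")
  case False
  then obtain v where "v \<in> S" by blast
  then show ?thesis using free4_degree[OF assms] card_nbh_compl[OF assms(1)] by fastforce
qed simp

text \<open>Each side has at most 2 of the other 4 vertices, hence exactly 2. So \<open>S\<close>
  induces a pentagon, the recurring local structure below.\<close>

lemma free4_card5:
  assumes "finite S" "\<not> thr E 4 S" "card S = 5" "v \<in> S"
  shows "card (nbh E v S) = 2"
  using free4_degree[OF assms(1,2,4)] card_nbh_compl[OF assms(1,4)] assms(3) by linarith

lemma free4_card4: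
  assumes "finite S" "\<not> thr E 4 S" "card S = 4" "v \<in> S"
  shows "card (nbh E v S) \<in> {1, 2}"
  using free4_degree[OF assms(1,2,4)] card_nbh_compl[OF assms(1,4)] assms(3) by auto

section \<open>Order 5 on eight vertices\<close>

lemma free5_nbh:
  assumes "finite S" "\<not> thr E 5 S" "v \<in> S"
  shows "\<not> thr E 4 (nbh E v S)" "\<not> thr E 4 (nbh (compl_rel E) v S)"
    "card (nbh E v S) \<le> 5" "card (nbh (compl_rel E) v S) \<le> 5"
proof -
  show *: "\<not> thr E 4 (nbh E v S)" "\<not> thr E 4 (nbh (compl_rel E) v S)"
    using free_step[OF assms(2,3), of 4] by simp_all
  show "card (nbh E v S) \<le> 5" "card (nbh (compl_rel E) v S) \<le> 5"
    using free4_card * assms(1) by auto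
qed

text \<open>The five non-neighbours of \<open>y\<close> induce a 2-regular graph, which has no room for a triangle.\<close>

lemma free5_triangle:
  assumes fin: "finite S" and free: "\<not> thr E 5 S"
    and y: "y \<in> S" "card (nbh (compl_rel E) y S) = 5"
    and T: "x \<in> nbh (compl_rel E) y S" "p \<in> nbh (compl_rel E) y S" "q \<in> nbh (compl_rel E) y S"
    and adj: "E x p" "E p q" "E q x"
  shows False
proof -
  let ?Y = "nbh (compl_rel E) y S"
  have finY: "finite ?Y" using fin by simp
  have freeY: "\<not> thr E 4 ?Y" using free5_nbh(2)[OF fin free y(1)] .
  have deg: "card (nbh E z ?Y) = 2" if "z \<in> ?Y" for z
    using free4_card5[OF finY freeY y(2) that] .
  have dist: "x \<noteq> p" "p \<noteq> q" "q \<noteq> x" using adj irrefl by auto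
  have nb: "nbh E x ?Y = {p, q}" "nbh E p ?Y = {x, q}" "nbh E q ?Y = {x, p}"
    by (rule card_subset_eq[symmetric]; use T adj dist sym deg finY in \<open>auto simp: in_nbh_iff\<close>)+
  have "card {x, p, q} = 3" using dist by auto
  then obtain z where z: "z \<in> ?Y" "z \<notin> {x, p, q}"
    using y(2) card_mono[of "{x, p, q}" ?Y] by fastforce
  have "nbh E z ?Y \<subseteq> ?Y - {x, p, q, z}"
    using nb z sym irrefl by (auto simp: in_nbh_iff set_eq_iff)
  moreover have "card (?Y - {x, p, q, z}) = 1"
    using T z y(2) dist finY by (subst card_Diff_subset) auto
  ultimately show False using deg[OF z(1)] card_mono[of "?Y - {x, p, q, z}" "nbh E z ?Y"] finY by auto
qed

text \<open>Degrees are at least 2, because at most 5 of the 7 other vertices are non-neighbours. If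
  all are at least 3, the sum is at least 24. Otherwise the non-neighbours of a vertex
  \<open>x\<close> of degree 2 form a pentagon \<open>?M\<close>, and the sum depends only on the
  edges that the two neighbours \<open>p\<close>, \<open>q\<close> of \<open>x\<close> send to each
  other and to \<open>?M\<close>.\<close>

lemma free5_card8:
  assumes fin: "finite S" and card: "card S = 8" and free: "\<not> thr E 5 S"
  shows "(\<Sum>v\<in>S. card (nbh E v S)) \<ge> 20"
    and "(\<Sum>v\<in>S. card (nbh E v S)) = 20 \<Longrightarrow> v \<in> S \<Longrightarrow> card (nbh E v S) \<le> 3"
proof -
  let ?d = "\<lambda>v. card (nbh E v S)"
  have dsum: "?d v + card (nbh (compl_rel E) v S) = 7" if "v \<in> S" for v
    using card_nbh_compl[OF fin that] card by simp
  have d2: "?d v \<ge> 2" if "v \<in> S" for v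
    using dsum[OF that] free5_nbh(4)[OF fin free that] by linarith
  have "sum ?d S \<ge> 20 \<and> (sum ?d S = 20 \<longrightarrow> (\<forall>v\<in>S. ?d v \<le> 3))"
  proof (cases "\<forall>v\<in>S. ?d v \<ge> 3")
    case True
    then have "sum ?d S \<ge> 8 * 3"
      using sum_bounded_below[of S 3 ?d] card by auto
    then show ?thesis by simp
  next
    case False
    then obtain x where x: "x \<in> S" "?d x = 2"
      using d2 by (metis Suc_leI antisym_conv2 eval_nat_numeral(3) not_less)
    let ?N = "nbh E x S" and ?M = "nbh (compl_rel E) x S"
    obtain p q where pq: "?N = {p, q}" "p \<noteq> q" using x(2) card_2_iff by metis
    have pS: "p \<in> S" "q \<in> S" "E x p" "E x q" "E p x" "E q x"
      using pq sym by (auto simp: nbh_def)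
    have cM: "card ?M = 5" using dsum[OF x(1)] x(2) by simp
    have finM: "finite ?M" using fin by simp
    have freeM: "\<not> thr E 4 ?M" using free5_nbh(2)[OF fin free x(1)] .
    have M2: "card (nbh E c ?M) = 2" if "c \<in> ?M" for c
      using free4_card5[OF finM freeM cM that] .
    note S = nbh_decomp[OF x(1), unfolded pq(1)]
    have nS: "?d v = of_bool (E v x) + (of_bool (E v p) + of_bool (E v q) + card (nbh E v ?M))" for v
    proof -
      have "card (nbh E v {p, q}) = of_bool (E v p) + of_bool (E v q)"
        using pq(2) card_nbh_insert[of "{q}" p E v] card_nbh_insert[of "{}" q E v]
        by (simp add: nbh_def)
      then show ?thesis using card_nbh_decomp[OF fin x(1), of v] pq(1) by simp
    qed
    let ?P = "nbh E p ?M" and ?Q = "nbh E q ?M"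
    have dp: "?d p = 1 + of_bool (E p q) + card ?P"
      using nS[of p] pS irrefl by simp
    have dq: "?d q = 1 + of_bool (E p q) + card ?Q"
      using nS[of q] pS irrefl sym by (auto simp: of_bool_def)
    have dM: "?d c = 2 + of_bool (c \<in> ?P) + of_bool (c \<in> ?Q)" if "c \<in> ?M" for c
      using nS[of c] that M2[OF that] sym by (auto simp: in_nbh_iff compl_rel_def of_bool_def split: if_splits)
    have "sum ?d ?M = (\<Sum>c\<in>?M. 2 + of_bool (c \<in> ?P) + of_bool (c \<in> ?Q))"
      using dM by (intro sum.cong) auto
    also have "\<dots> = 10 + card ?P + card ?Q"
      unfolding sum.distrib
      using sum_of_bool_subset[OF finM nbh_subset[of E _ ?M]] cM by simp
    finally have sM: "sum ?d ?M = 10 + card ?P + card ?Q" .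
    have "sum ?d S = ?d x + sum ?d ({p, q} \<union> ?M)"
      by (subst (2) S(1), subst sum.insert) (use S finM in auto)
    also have "sum ?d ({p, q} \<union> ?M) = ?d p + ?d q + sum ?d ?M"
      using S finM pq(2) by (subst sum.union_disjoint) auto
    finally have tot: "sum ?d S = 14 + 2 * of_bool (E p q) + 2 * (card ?P + card ?Q)"
      using x(2) dp dq sM by simp
    show ?thesis
    proof (cases "E p q")
      case True
      \<comment> \<open>A vertex of \<open>?M\<close> adjacent to neither \<open>p\<close> nor
        \<open>q\<close> would have degree 2, and its five non-neighbours would contain the triangle
        \<open>x\<close>, \<open>p\<close>, \<open>q\<close>.\<close>
      have "?M \<subseteq> ?P \<union> ?Q"
      proof
        fix y assume y: "y \<in> ?M"
        show "y \<in> ?P \<union> ?Q"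
        proof (rule ccontr)
          assume n: "y \<notin> ?P \<union> ?Q"
          then have "?d y = 2" using dM[OF y] by simp
          moreover have yS: "y \<in> S" using y by (simp add: in_nbh_iff compl_rel_def)
          ultimately have "card (nbh (compl_rel E) y S) = 5" using dsum[OF yS] by simp
          moreover have "x \<in> nbh (compl_rel E) y S" "p \<in> nbh (compl_rel E) y S" "q \<in> nbh (compl_rel E) y S"
            using y n x pS sym S by (auto simp: in_nbh_iff compl_rel_def)
          ultimately show False
            using free5_triangle[OF fin free yS, of x p q] pS True by blast
        qed
      qed
      then have "5 \<le> card (?P \<union> ?Q)"
        using cM finM by (metis card_mono finite_UnI finite_nbh)
      also have "\<dots> \<le> card ?P + card ?Q" by (rule card_Un_le)
      finally show ?thesis using tot True by simp
    next
      case npq: False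
      \<comment> \<open>Here \<open>a\<close> has degree 2, so its non-neighbours form a pentagon,
        in which \<open>b\<close> has degree 2. This rules out that \<open>?P\<close> and
        \<open>?Q\<close> are both singletons.\<close>
      have key: "card (nbh E b ?M - nbh E a ?M) = 2"
        if ab: "{a, b} = {p, q}" and one: "card (nbh E a ?M) = 1" for a b
      proof -
        have aS: "a \<in> S" "b \<in> S" "a \<noteq> b" "\<not> E a b" "\<not> E b a" "E a x" "E b x"
          using ab pS pq(2) npq sym by (auto simp: doubleton_eq_iff)
        have "?d a = 2" using dp dq one ab npq by (auto simp: doubleton_eq_iff)
        then have c5: "card (nbh (compl_rel E) a S) = 5" using dsum[OF aS(1)] by simp
        have "b \<in> nbh (compl_rel E) a S" using aS by (simp add: in_nbh_iff compl_rel_def)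
        then have "card (nbh E b (nbh (compl_rel E) a S)) = 2"
          using free4_card5[OF _ free5_nbh(2)[OF fin free aS(1)] c5] fin by simp
        moreover have "nbh E b (nbh (compl_rel E) a S) = nbh E b ?M - nbh E a ?M"
        proof -
          have "z \<in> ?M" if "z \<in> S" "E b z" "\<not> E a z" for z
          proof -
            have "z \<noteq> x" "z \<noteq> p" "z \<noteq> q"
              using that ab aS irrefl by (auto simp: doubleton_eq_iff)
            then show ?thesis using that(1) S(1) by blast
          qed
          then show ?thesis using aS
            by (auto simp: in_nbh_iff compl_rel_def)
        qed
        ultimately show ?thesis by simp
      qed
      have P1: "card ?P \<ge> 1" "card ?Q \<ge> 1"
        using d2[OF pS(1)] d2[OF pS(2)] dp dq npq by auto
      have kp: "card (?Q - ?P) = 2" if "card ?P = 1" using key[of p q] that by simp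
      have kq: "card (?P - ?Q) = 2" if "card ?Q = 1" using key[of q p] that by (simp add: insert_commute)
      have le: "card (?Q - ?P) \<le> card ?Q" "card (?P - ?Q) \<le> card ?P"
        using finM by (auto intro!: card_mono)
      have three: "card ?P + card ?Q \<ge> 3" using P1 kp le by linarith
      \<comment> \<open>This is the case of sum 20: the sizes are 1 and 2, and \<open>key\<close>
        then makes \<open>?P\<close> and \<open>?Q\<close> disjoint, so no vertex of
        \<open>?M\<close> gains two neighbours.\<close>
      moreover have "\<forall>v\<in>S. ?d v \<le> 3" if "card ?P + card ?Q = 3"
      proof -
        have "card ?P = 1 \<and> card ?Q = 2 \<or> card ?P = 2 \<and> card ?Q = 1"
          using that P1 by linarith
        then have "?P \<inter> ?Q = {}"
        proof
          assume a: "card ?P = 1 \<and> card ?Q = 2"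
          then have "?Q - ?P = ?Q" using kp finM by (intro card_subset_eq) auto
          then show ?thesis by blast
        next
          assume a: "card ?P = 2 \<and> card ?Q = 1"
          then have "?P - ?Q = ?P" using kq finM by (intro card_subset_eq) auto
          then show ?thesis by blast
        qed
        then have "?d c \<le> 3" if "c \<in> ?M" for c
          using dM[OF that] by auto
        moreover have "?d p \<le> 3" "?d q \<le> 3" "?d x \<le> 3"
          using dp dq npq x(2) that P1 by auto
        ultimately show ?thesis using S(1) by (metis Un_iff insert_iff empty_iff)
      qed
      ultimately show ?thesis using tot npq by auto
    qed
  qed
  then show "sum ?d S \<ge> 20" "sum ?d S = 20 \<Longrightarrow> v \<in> S \<Longrightarrow> ?d v \<le> 3" by auto
qed

section \<open>Order 5 on nine vertices: the Paley parameters\<close>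

text \<open>The non-neighbours of a vertex \<open>x\<close> of degree 3 would form a pentagon
  \<open>?M\<close>. The three neighbours of \<open>x\<close> turn out to be independent, each with
  two neighbours in \<open>?M\<close> that it shares with no other: six vertices in a set of
  five.\<close>

lemma free5_card9_degree_ge:
  assumes fin: "finite S" and card: "card S = 9" and free: "\<not> thr E 5 S" and x: "x \<in> S"
  shows "card (nbh E x S) \<ge> 4"
proof (rule ccontr)
  let ?d = "\<lambda>v. card (nbh E v S)"
  let ?N = "nbh E x S" and ?M = "nbh (compl_rel E) x S"
  have dsum: "?d v + card (nbh (compl_rel E) v S) = 8" if "v \<in> S" for v
    using card_nbh_compl[OF fin that] card by simp
  have d3: "?d v \<ge> 3" if "v \<in> S" for v
    using dsum[OF that] free5_nbh(4)[OF fin free that] by linarith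
  assume "\<not> ?d x \<ge> 4"
  then have N3: "card ?N = 3" and M5: "card ?M = 5"
    using d3[OF x] dsum[OF x] by auto
  have finN: "finite ?N" and finM: "finite ?M" using fin by auto
  have M2: "card (nbh E c ?M) = 2" if "c \<in> ?M" for c
    using free4_card5[OF finM free5_nbh(2)[OF fin free x] M5 that] .
  have inS: "z \<in> S" if "z \<in> ?N \<or> z \<in> ?M" for z
    using that by (auto simp: in_nbh_iff)
  have cross: "card (nbh E c ?N) \<ge> 1" if c: "c \<in> ?M" for c
  proof -
    have "\<not> E c x" using c sym by (auto simp: in_nbh_iff compl_rel_def)
    then show ?thesis
      using card_nbh_decomp[OF fin x, of c] d3[of c] inS[of c] c M2[OF c] by auto
  qed
  \<comment> \<open>The neighbours of \<open>z\<close> in \<open>?M\<close> are the non-neighbours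
    of \<open>x\<close> within the neighbourhood of \<open>z\<close>, which has no threshold
    subgraph of order 4.\<close>
  have P2: "card (nbh E z ?M) \<le> 2" if z: "z \<in> ?N" for z
  proof -
    have zS: "z \<in> S" and xz: "E z x" using z sym by (auto simp: in_nbh_iff)
    have "x \<in> nbh E z S" using x xz by (simp add: in_nbh_iff)
    then have "card (nbh (compl_rel E) x (nbh E z S)) \<le> 2"
      using free4_degree(2)[OF _ free5_nbh(1)[OF fin free zS]] fin by auto
    also have "nbh (compl_rel E) x (nbh E z S) = nbh E z ?M"
      by (auto simp: nbh_def)
    finally show ?thesis .
  qed
  \<comment> \<open>Otherwise the edges between \<open>?N\<close> and \<open>?M\<close> number at least \<open>5 + card (nbh E z ?M)\<close>, but at most
    \<open>card (nbh E z ?M) + 4\<close>.\<close>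
  have sole: "\<exists>c\<in>?M. nbh E c ?N = {z}" if z: "z \<in> ?N" for z
  proof (rule ccontr)
    assume none: "\<not> ?thesis"
    have "(\<Sum>c\<in>?M. 1 + of_bool (c \<in> nbh E z ?M)) \<le> (\<Sum>c\<in>?M. card (nbh E c ?N))"
    proof (rule sum_mono)
      fix c assume c: "c \<in> ?M"
      have "card (nbh E c ?N) \<noteq> 1" if "E z c"
      proof
        assume "card (nbh E c ?N) = 1"
        then obtain w where "nbh E c ?N = {w}" using card_1_singletonE by blast
        moreover have "z \<in> nbh E c ?N" using z that sym by (simp add: in_nbh_iff)
        ultimately show False using none c by auto
      qed
      then show "1 + of_bool (c \<in> nbh E z ?M) \<le> card (nbh E c ?N)"
        using cross[OF c] by (auto simp: in_nbh_iff of_bool_def)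
    qed
    also have "\<dots> = (\<Sum>w\<in>?N. card (nbh E w ?M))"
      using double_count[OF finM finN] .
    also have "\<dots> = card (nbh E z ?M) + (\<Sum>w\<in>?N - {z}. card (nbh E w ?M))"
      using z finN by (simp add: sum.remove)
    also have "(\<Sum>w\<in>?N - {z}. card (nbh E w ?M)) \<le> of_nat (card (?N - {z})) * 2"
      by (rule sum_bounded_above) (use P2 in auto)
    also have "card (?N - {z}) = 2" using z N3 finN by simp
    finally show False
      using sum_of_bool_subset[OF finM nbh_subset[of E z ?M]] M5 by (simp only: sum.distrib) simp
  qed
  \<comment> \<open>Take \<open>c\<close> in \<open>?M\<close> attached only to the third vertex
    \<open>z\<close> of \<open>?N\<close>. It has degree 3, so an edge between \<open>a\<close> and
    \<open>b\<close> would give a triangle \<open>x\<close>, \<open>a\<close>, \<open>b\<close>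
    among its five non-neighbours.\<close>
  have indep: "\<not> E a b" if ab: "a \<in> ?N" "b \<in> ?N" for a b
  proof
    assume adj: "E a b"
    have abn: "a \<noteq> b" using adj irrefl by auto
    then have "card (?N - {a, b}) = 1"
      using ab N3 finN by (subst card_Diff_subset) auto
    then obtain z where "?N - {a, b} = {z}" using card_1_singletonE by blast
    then have z: "z \<in> ?N" "z \<noteq> a" "z \<noteq> b" by auto
    obtain c where c: "c \<in> ?M" "nbh E c ?N = {z}" using sole[OF z(1)] by blast
    have cS: "c \<in> S" and cx: "\<not> E c x" and cnx: "c \<noteq> x"
      using c(1) sym by (auto simp: in_nbh_iff compl_rel_def)
    have "?d c = 3"
      using card_nbh_decomp[OF fin x, of c] c(2) M2[OF c(1)] cx by simp
    then have c5: "card (nbh (compl_rel E) c S) = 5" using dsum[OF cS] by simp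
    have "\<not> E c a" "\<not> E c b" using c(2) ab z by (auto simp: in_nbh_iff set_eq_iff)
    then show False
      using free5_triangle[OF fin free cS c5, of x a b] x ab cx cnx c(1) adj sym
      by (auto simp: in_nbh_iff compl_rel_def)
  qed
  have dz: "?d z = 3 \<and> card (nbh E z ?M) = 2" if z: "z \<in> ?N" for z
  proof -
    have "nbh E z ?N = {}" using indep[OF z] by (auto simp: in_nbh_iff)
    moreover have "E z x" using z sym by (auto simp: in_nbh_iff)
    ultimately show ?thesis
      using card_nbh_decomp[OF fin x, of z] P2[OF z] d3[of z] inS[of z] z by auto
  qed
  \<comment> \<open>In the pentagon of non-neighbours of \<open>a\<close>, the vertex
    \<open>b\<close> has two neighbours. They lie in \<open>?M\<close>, where \<open>b\<close> has
    only two, so none of those is adjacent to \<open>a\<close>.\<close>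
  have disj: "nbh E a ?M \<inter> nbh E b ?M = {}" if ab: "a \<in> ?N" "b \<in> ?N" "a \<noteq> b" for a b
  proof -
    have aS: "a \<in> S" "b \<in> S" using ab inS by auto
    have "card (nbh (compl_rel E) a S) = 5" using dz[OF ab(1)] dsum[OF aS(1)] by simp
    moreover have "b \<in> nbh (compl_rel E) a S"
      using aS ab indep[OF ab(1,2)] by (auto simp: in_nbh_iff compl_rel_def)
    ultimately have two: "card (nbh E b (nbh (compl_rel E) a S)) = 2"
      using free4_card5[OF _ free5_nbh(2)[OF fin free aS(1)]] fin by auto
    have "nbh E b (nbh (compl_rel E) a S) \<subseteq> nbh E b ?M"
    proof
      fix w assume "w \<in> nbh E b (nbh (compl_rel E) a S)"
      then have w: "w \<in> S" "E b w" "\<not> E a w" by (auto simp: in_nbh_iff compl_rel_def)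
      have "E a x" using ab(1) sym by (auto simp: in_nbh_iff)
      then have "w \<noteq> x" using w by auto
      moreover have "\<not> E x w" using indep[OF ab(2), of w] w by (auto simp: in_nbh_iff)
      ultimately show "w \<in> nbh E b ?M" using w by (auto simp: in_nbh_iff compl_rel_def)
    qed
    then have "nbh E b (nbh (compl_rel E) a S) = nbh E b ?M"
      using two dz[OF ab(2)] finM by (intro card_subset_eq) auto
    then show ?thesis by (auto simp: in_nbh_iff compl_rel_def set_eq_iff)
  qed
  have "card (\<Union>z\<in>?N. nbh E z ?M) = (\<Sum>z\<in>?N. card (nbh E z ?M))"
    using finN finM disj by (intro card_UN_disjoint) auto
  also have "\<dots> = 6" using dz N3 by simp
  finally have "6 \<le> card ?M"
    using card_mono[OF finM, of "\<Union>z\<in>?N. nbh E z ?M"] nbh_subset[of E _ ?M] by auto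
  then show False using M5 by simp
qed

text \<open>The lower bound 4 holds in the graph and in its complement, and only 8 other vertices
  are available.\<close>

lemma free5_card9_regular:
  assumes "finite S" "card S = 9" "\<not> thr E 5 S" "x \<in> S"
  shows "card (nbh E x S) = 4" "card (nbh (compl_rel E) x S) = 4"
  using free5_card9_degree_ge[OF assms] card_nbh_compl[OF assms(1,4)] assms(2)
    graph_rel.free5_card9_degree_ge[OF compl_graph_rel assms(1,2) _ assms(4)] assms(3)
  unfolding thr_compl by auto

text \<open>Both sides of \<open>v\<close> have four vertices with inner degrees 1 or 2. So a vertex
  of \<open>?D\<close> sends at most 2 edges to \<open>?F\<close>, a vertex of \<open>?F\<close> at
  least 2 edges to \<open>?D\<close>, and double counting forces equality everywhere.\<close>

lemma free5_card9_common:
  assumes fin: "finite S" and card: "card S = 9" and free: "\<not> thr E 5 S"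
    and v: "v \<in> S" and u: "u \<in> S"
  shows "E u v \<Longrightarrow> card (nbh E u (nbh E v S)) = 1"
    and "u \<noteq> v \<Longrightarrow> \<not> E u v \<Longrightarrow> card (nbh E u (nbh E v S)) = 2"
proof -
  let ?D = "nbh E v S" and ?F = "nbh (compl_rel E) v S"
  note reg = free5_card9_regular[OF fin card free]
  have finD: "finite ?D" and finF: "finite ?F" using fin by auto
  have freeD: "\<not> thr E 4 ?D" and freeF: "\<not> thr E 4 ?F"
    using free5_nbh(1,2)[OF fin free v] by auto
  have D: "card (nbh E w ?F) + card (nbh E w ?D) = 3 \<and> card (nbh E w ?D) \<ge> 1" if w: "w \<in> ?D" for w
  proof -
    have "w \<in> S" "E w v" using w sym by (auto simp: in_nbh_iff)
    then show ?thesis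
      using card_nbh_decomp[OF fin v, of w] reg(1)[of w] free4_card4[OF finD freeD reg(1)[OF v] w]
      by auto
  qed
  have F: "card (nbh E w ?D) + card (nbh E w ?F) = 4 \<and> card (nbh E w ?F) \<le> 2" if w: "w \<in> ?F" for w
  proof -
    have "w \<in> S" "\<not> E w v" using w sym by (auto simp: in_nbh_iff compl_rel_def)
    then show ?thesis
      using card_nbh_decomp[OF fin v, of w] reg(1)[of w] free4_card4[OF finF freeF reg(2)[OF v] w]
      by auto
  qed
  have eq: "(\<Sum>w\<in>?D. card (nbh E w ?F)) = (\<Sum>w\<in>?F. card (nbh E w ?D))"
    using double_count[OF finD finF] .
  have le: "(\<Sum>w\<in>?D. card (nbh E w ?F)) \<le> (\<Sum>w\<in>?D. 2)"
    by (rule sum_mono) (use D in fastforce)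
  have ge: "(\<Sum>w\<in>?F. 2) \<le> (\<Sum>w\<in>?F. card (nbh E w ?D))"
    by (rule sum_mono) (use F in fastforce)
  have eqs: "(\<Sum>w\<in>?D. card (nbh E w ?F)) = (\<Sum>w\<in>?D. 2)" "(\<Sum>w\<in>?F. 2) = (\<Sum>w\<in>?F. card (nbh E w ?D))"
    using eq le ge reg[OF v] by auto
  {
    assume "E u v"
    then have uD: "u \<in> ?D" using u sym by (simp add: in_nbh_iff)
    have "card (nbh E u ?F) = 2"
      using sum_mono_inv[OF eqs(1) _ uD finD] D by fastforce
    then show "card (nbh E u ?D) = 1" using D[OF uD] by simp
  next
    assume "u \<noteq> v" "\<not> E u v"
    then have uF: "u \<in> ?F" using u sym by (auto simp: in_nbh_iff compl_rel_def)
    show "card (nbh E u ?D) = 2"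
      using sum_mono_inv[OF eqs(2) _ uF finF] F by fastforce
  }
qed

text \<open>Deleting any vertex from a set of ten leaves a 4-regular graph. So the degree of
  \<open>v\<close> is 5 or 4 according to its adjacency to \<open>w\<close>, whichever
  \<open>w\<close> is chosen. Then \<open>v\<close> is adjacent to all or to none, and its degree is
  9 or 0.\<close>

lemma free5_card_le:
  assumes fin: "finite S" and free: "\<not> thr E 5 S"
  shows "card S \<le> 9"
proof (rule ccontr)
  assume "\<not> card S \<le> 9"
  then obtain T where T: "T \<subseteq> S" "card T = 10" "finite T"
    using obtain_subset_with_card_n[of 10 S] by auto
  have deg: "card (nbh E v T) = of_bool (E v w) + 4" if "v \<in> T" "w \<in> T" "v \<noteq> w" for v w
  proof -
    have "card (T - {w}) = 9" using that T by simp
    moreover have "\<not> thr E 5 (T - {w})" using free T(1) thr_mono[of E 5 "T - {w}" S] by blast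
    ultimately have "card (nbh E v (T - {w})) = 4"
      using free5_card9_regular(1)[of "T - {w}" v] T(3) that by auto
    then show ?thesis
      using card_nbh_insert[of "T - {w}" w E v] T(3) that by (simp add: insert_absorb)
  qed
  have "T \<noteq> {}" using T(2) by auto
  then obtain v where v: "v \<in> T" by blast
  have "nbh E v T = {} \<or> nbh E v T = T - {v}"
  proof (rule ccontr)
    assume "\<not> ?thesis"
    then obtain w w' where "w \<in> T" "E v w" "w' \<in> T" "w' \<noteq> v" "\<not> E v w'"
      using irrefl by (auto simp: nbh_def)
    then show False using deg[OF v, of w] deg[OF v, of w'] irrefl by (cases "v = w") auto
  qed
  then have "card (nbh E v T) \<in> {0, 9}" using v T by auto
  moreover obtain w where "w \<in> T" "w \<noteq> v"
  proof -
    have "card (T - {v}) = 9" using T v by simp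
    then have "T - {v} \<noteq> {}" by (metis card.empty zero_neq_numeral)
    then show ?thesis using that by blast
  qed
  ultimately show False using deg[OF v, of w] by (auto simp: of_bool_def split: if_splits)
qed

section \<open>Order 6 on 18 vertices: regularity\<close>

lemma free6_nbh:
  assumes fin: "finite V" and card: "card V = 18" and free: "\<not> thr E 6 V" and v: "v \<in> V"
  shows "\<not> thr E 5 (nbh E v V)" "\<not> thr E 5 (nbh (compl_rel E) v V)"
    "card (nbh E v V) + card (nbh (compl_rel E) v V) = 17"
    "card (nbh E v V) = 8 \<or> card (nbh E v V) = 9"
proof -
  show *: "\<not> thr E 5 (nbh E v V)" "\<not> thr E 5 (nbh (compl_rel E) v V)"
    using free_step[OF free v, of 5] by simp_all
  show "card (nbh E v V) + card (nbh (compl_rel E) v V) = 17"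
    using card_nbh_compl[OF fin v] card by simp
  moreover have "card (nbh E v V) \<le> 9" "card (nbh (compl_rel E) v V) \<le> 9"
    using free5_card_le * fin by auto
  ultimately show "card (nbh E v V) = 8 \<or> card (nbh E v V) = 9" by linarith
qed

text \<open>With k = \<open>card (nbh E v R)\<close>, counting the edges between the two sides of
  \<open>v\<close> from both ends gives the complement of \<open>?F\<close> the degree sum
  \<open>20 + 2 * k - card R\<close>. Both claims are then those of
  \<open>free5_card8\<close>.\<close>

lemma free6_degree_nine:
  assumes fin: "finite V" and card: "card V = 18" and free: "\<not> thr E 6 V"
    and R: "R = {u \<in> V. card (nbh E u V) = 9}" and v: "v \<in> R"
  shows "card R \<le> 2 * card (nbh E v R)"
    and "card R = 2 * card (nbh E v R) \<Longrightarrow> w \<in> nbh (compl_rel E) v V \<Longrightarrow>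
      card (nbh (compl_rel E) w (nbh (compl_rel E) v V)) \<le> 3"
proof -
  interpret C: graph_rel "compl_rel E" by (rule compl_graph_rel)
  let ?D = "nbh E v V" and ?F = "nbh (compl_rel E) v V"
  have vV: "v \<in> V" and cD: "card ?D = 9" using v R by auto
  note f6 = free6_nbh[OF fin card free]
  have cF: "card ?F = 8" using f6(3)[OF vV] cD by simp
  have finD: "finite ?D" and finF: "finite ?F" and finR: "finite R" using fin R by auto
  have freeF: "\<not> thr (compl_rel E) 5 ?F" using f6(2)[OF vV] by (simp add: thr_compl)
  let ?X = "\<Sum>u\<in>?D. card (nbh E u ?F)" and ?Y = "\<Sum>w\<in>?F. card (nbh E w ?F)"
  let ?Z = "\<Sum>w\<in>?F. card (nbh (compl_rel E) w ?F)"
  have deg: "card (nbh E u V) = 8 + of_bool (u \<in> R)" if "u \<in> V" for u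
    using f6(4)[OF that] that R by auto
  have RD: "nbh E v R \<subseteq> ?D" and RF: "nbh (compl_rel E) v R \<subseteq> ?F"
    using R by (auto simp: in_nbh_iff)
  \<comment> \<open>The 5 accounts for \<open>v\<close> and the four neighbours of \<open>u\<close>
    in the 4-regular graph on \<open>?D\<close>.\<close>
  have "(\<Sum>u\<in>?D. 5 + card (nbh E u ?F)) = (\<Sum>u\<in>?D. 8 + of_bool (u \<in> nbh E v R))"
  proof (rule sum.cong[OF refl])
    fix u assume u: "u \<in> ?D"
    then have "card (nbh E u ?D) = 4"
      using free5_card9_regular(1)[OF finD cD f6(1)[OF vV]] by blast
    moreover have "u \<in> V" "E u v" "u \<in> R \<longleftrightarrow> u \<in> nbh E v R"
      using u sym by (auto simp: in_nbh_iff)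
    ultimately show "5 + card (nbh E u ?F) = 8 + of_bool (u \<in> nbh E v R)"
      using card_nbh_decomp[OF fin vV, of u] deg[of u] by simp
  qed
  then have X: "45 + ?X = 72 + card (nbh E v R)"
    using sum_of_bool_subset[OF finD RD] cD by (simp only: sum.distrib) simp
  have "(\<Sum>w\<in>?F. card (nbh E w ?D) + card (nbh E w ?F))
      = (\<Sum>w\<in>?F. 8 + of_bool (w \<in> nbh (compl_rel E) v R))"
  proof (rule sum.cong[OF refl])
    fix w assume w: "w \<in> ?F"
    then have "w \<in> V" "\<not> E w v" "w \<in> R \<longleftrightarrow> w \<in> nbh (compl_rel E) v R"
      using sym by (auto simp: in_nbh_iff compl_rel_def)
    then show "card (nbh E w ?D) + card (nbh E w ?F) = 8 + of_bool (w \<in> nbh (compl_rel E) v R)"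
      using card_nbh_decomp[OF fin vV, of w] deg[of w] by simp
  qed
  then have Y: "?X + ?Y = 64 + card (nbh (compl_rel E) v R)"
    using sum_of_bool_subset[OF finF RF] cF double_count[OF finD finF]
    by (simp only: sum.distrib) simp
  have "(\<Sum>w\<in>?F. card (nbh E w ?F) + card (nbh (compl_rel E) w ?F)) = (\<Sum>w\<in>?F. 7)"
    using card_nbh_compl[OF finF] cF by (intro sum.cong) auto
  then have Z: "?Y + ?Z = 56" using cF by (simp add: sum.distrib)
  have Z20: "?Z \<ge> 20" using C.free5_card8(1)[OF finF cF freeF] .
  have k: "card (nbh E v R) + card (nbh (compl_rel E) v R) + 1 = card R"
    using card_nbh_compl[OF finR v] .
  show "card R \<le> 2 * card (nbh E v R)" using X Y Z Z20 k by linarith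
  assume "card R = 2 * card (nbh E v R)" and w: "w \<in> ?F"
  then have "?Z = 20" using X Y Z k by linarith
  then show "card (nbh (compl_rel E) w ?F) \<le> 3"
    using C.free5_card8(2)[OF finF cF freeF _ w] by blast
qed

text \<open>The vertices of degree 8 form the set \<open>B\<close> of degree 9 in the complement. By
  \<open>free6_degree_nine\<close> for both graphs, a vertex of \<open>R\<close> is adjacent to at
  most half of \<open>B\<close> and a vertex of \<open>B\<close> to at least half of
  \<open>R\<close>. Double counting makes all these bounds equalities.\<close>

lemma free6_regular:
  assumes fin: "finite V" and card: "card V = 18" and free: "\<not> thr E 6 V"
    and R: "R = {u \<in> V. card (nbh E u V) = 9}" and ne: "R \<noteq> {}"
  shows "R = V"
    and "v \<in> V \<Longrightarrow> w \<in> nbh (compl_rel E) v V \<Longrightarrow>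
      card (nbh (compl_rel E) w (nbh (compl_rel E) v V)) \<le> 3"
proof -
  interpret C: graph_rel "compl_rel E" by (rule compl_graph_rel)
  note f6 = free6_nbh[OF fin card free]
  have Cfree: "\<not> thr (compl_rel E) 6 V" using free by (simp add: thr_compl)
  define B where "B = {u \<in> V. card (nbh (compl_rel E) u V) = 9}"
  have B: "B = V - R"
    unfolding B_def R using f6(3,4) by fastforce
  have finR: "finite R" and finB: "finite B" and RV: "R \<subseteq> V" using fin R B by auto
  have km: "card R + card B = 18"
    using B RV fin card card_mono[OF fin RV] by (simp add: card_Diff_subset finR)
  note degR = free6_degree_nine[OF fin card free R]
  note degB = C.free6_degree_nine[OF fin card Cfree B_def, unfolded compl_compl]
  have RB: "card (nbh E v R) + card (nbh E v B) = 9" if "v \<in> R" for v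
    using card_nbh_split[OF fin, of R B E v] B RV that R by auto
  have BR: "card (nbh E b R) + 9 = card R + card (nbh (compl_rel E) b B)" if b: "b \<in> B" for b
  proof -
    have "card (nbh (compl_rel E) b R) + card (nbh (compl_rel E) b B) = 9"
    proof -
      have "card (nbh (compl_rel E) b V) = 9" using b by (simp add: B_def)
      then show ?thesis
        using card_nbh_split[OF fin, of R B "compl_rel E" b] B RV by auto
    qed
    moreover have "card (nbh E b R) + card (nbh (compl_rel E) b R) = card R"
    proof -
      have "nbh E b R \<union> nbh (compl_rel E) b R = R" "nbh E b R \<inter> nbh (compl_rel E) b R = {}"
        using b B by (auto simp: in_nbh_iff compl_rel_def)
      then show ?thesis using finR by (metis card_Un_disjoint finite_nbh)
    qed
    ultimately show ?thesis by linarith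
  qed
  have R_le: "2 * card (nbh E v B) \<le> card B" if "v \<in> R" for v
    using RB[OF that] degR(1)[OF that] km by linarith
  have B_ge: "card R \<le> 2 * card (nbh E b R)" if "b \<in> B" for b
    using BR[OF that] degB(1)[OF that] km by linarith
  have le: "(\<Sum>v\<in>R. 2 * card (nbh E v B)) \<le> (\<Sum>v\<in>R. card B)"
    by (rule sum_mono) (use R_le in auto)
  have ge: "(\<Sum>b\<in>B. card R) \<le> (\<Sum>b\<in>B. 2 * card (nbh E b R))"
    by (rule sum_mono) (use B_ge in auto)
  have "(\<Sum>v\<in>R. 2 * card (nbh E v B)) = (\<Sum>b\<in>B. 2 * card (nbh E b R))"
    using double_count[OF finR finB] by (simp flip: sum_distrib_left)
  then have eqs: "(\<Sum>v\<in>R. 2 * card (nbh E v B)) = (\<Sum>v\<in>R. card B)"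
    "(\<Sum>b\<in>B. card R) = (\<Sum>b\<in>B. 2 * card (nbh E b R))"
    using le ge by (simp_all add: mult.commute)
  have R_eq: "2 * card (nbh E v B) = card B" if "v \<in> R" for v
    using sum_mono_inv[OF eqs(1) R_le that finR] .
  have B_eq: "card R = 2 * card (nbh E b R)" if "b \<in> B" for b
    using sum_mono_inv[OF eqs(2) B_ge that finB] .
  have kR: "card R = 2 * card (nbh E v R)" if "v \<in> R" for v
    using R_eq[OF that] RB[OF that] km by linarith
  have kB: "card B = 2 * card (nbh (compl_rel E) b B)" if "b \<in> B" for b
    using B_eq[OF that] BR[OF that] km by linarith
  \<comment> \<open>For an edge between \<open>v\<close> and \<open>b\<close>, the equality case at
    \<open>b\<close> in the complement allows at most 3 common neighbours, but 4-regularity of the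
    neighbourhood of \<open>v\<close> gives 4.\<close>
  have no_edge: "nbh E v B = {}" if v: "v \<in> R" for v
  proof (rule ccontr)
    assume "nbh E v B \<noteq> {}"
    then obtain b where b: "b \<in> B" "E v b" by (auto simp: nbh_def)
    have V: "v \<in> V" "b \<in> V" "card (nbh E v V) = 9" using v b R B by auto
    have "card (nbh E v (nbh E b V)) \<le> 3"
      using degB(2)[OF b(1) kB[OF b(1)], of v] V sym b(2) by (simp add: in_nbh_iff)
    moreover have "nbh E v (nbh E b V) = nbh E b (nbh E v V)" by (auto simp: nbh_def)
    moreover have "card (nbh E b (nbh E v V)) = 4"
      using free5_card9_regular(1)[OF _ V(3) f6(1)[OF V(1)]] b V fin by (simp add: in_nbh_iff)
    ultimately show False by simp
  qed
  obtain r where r: "r \<in> R" using ne by blast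
  then have "card B = 0" using R_eq[OF r] no_edge[OF r] by simp
  then show RV': "R = V" using finB B RV by auto
  show "card (nbh (compl_rel E) w (nbh (compl_rel E) v V)) \<le> 3"
    if "v \<in> V" "w \<in> nbh (compl_rel E) v V"
    using degR(2)[OF _ kR] that RV' by blast
qed

section \<open>Order 6 on 18 vertices: the pentagon\<close>

text \<open>The pentagon on \<open>S\<close> gets the cyclic labels \<open>y\<close>,
  \<open>a\<close>, \<open>c\<close>, \<open>d\<close>, \<open>b\<close>. The contradiction is with
  \<open>uniq\<close>: no edge of \<open>P\<close> lies in two triangles.\<close>

lemma free5_card9_no_pentagon:
  assumes fin: "finite P" and card: "card P = 9" and free: "\<not> thr E 5 P"
    and S: "S \<subseteq> P" "card S = 5"
    and two: "\<And>u. u \<in> S \<Longrightarrow> card (nbh E u S) = 2"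
    and tri: "\<And>u p q. u \<in> S \<Longrightarrow> p \<in> nbh E u S \<Longrightarrow> q \<in> nbh E u S \<Longrightarrow> \<not> E p q"
  shows False
proof -
  have finS: "finite S" using S fin finite_subset by blast
  note common = free5_card9_common[OF fin card free]
  have uniq: "s = t"
    if "u \<in> P" "w \<in> P" "E u w" "s \<in> P" "t \<in> P" "E u s" "E w s" "E u t" "E w t" for u w s t
  proof -
    have "card (nbh E u (nbh E w P)) = 1" using common(1)[of w u] that by blast
    moreover have "s \<in> nbh E u (nbh E w P)" "t \<in> nbh E u (nbh E w P)"
      using that by (auto simp: in_nbh_iff)
    ultimately show ?thesis by (metis card_1_singletonE singletonD)
  qed
  obtain y where y: "y \<in> S" using S(2) by fastforce
  obtain a b where ab: "nbh E y S = {a, b}" "a \<noteq> b" using two[OF y] card_2_iff by metis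
  have abS: "a \<in> S" "b \<in> S" "E y a" "E y b" "E a y" "E b y" using ab sym by (auto simp: nbh_def)
  have nab: "\<not> E a b" "\<not> E b a" using tri[OF y, of a b] tri[OF y, of b a] ab by auto
  have yab: "y \<noteq> a" "y \<noteq> b" using abS irrefl by auto
  have other: "\<exists>c. nbh E u S = {y, c} \<and> c \<noteq> y" if "u \<in> S" "E u y" for u
  proof -
    have "y \<in> nbh E u S" using that y by (simp add: in_nbh_iff)
    moreover obtain p q where "nbh E u S = {p, q}" "p \<noteq> q"
      using two[OF \<open>u \<in> S\<close>] card_2_iff by metis
    ultimately show ?thesis by auto
  qed
  obtain c where c: "nbh E a S = {y, c}" "c \<noteq> y" using other abS by blast
  obtain d where d: "nbh E b S = {y, d}" "d \<noteq> y" using other abS by blast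
  have cS: "c \<in> S" "E a c" "E c a" and dS: "d \<in> S" "E b d" "E d b"
    using c d sym by (auto simp: nbh_def)
  have cab: "c \<noteq> a" "c \<noteq> b" and dab: "d \<noteq> a" "d \<noteq> b"
    using cS dS irrefl nab by auto
  then have cn: "c \<noteq> a" "c \<noteq> b" "\<not> E y c" and dn: "d \<noteq> a" "d \<noteq> b" "\<not> E y d"
    using cS(1) dS(1) in_nbh_iff[of c E y S] in_nbh_iff[of d E y S] ab(1) by auto
  \<comment> \<open>Otherwise \<open>y\<close>, \<open>a\<close>, \<open>c\<close>, \<open>b\<close>
    would be a 4-cycle using up all their degrees, and the fifth vertex would be isolated.\<close>
  have cd: "c \<noteq> d"
  proof
    assume eq: "c = d"
    have "card (S - {y, a, b, c}) = 1"
      using S(2) finS y abS cS yab ab(2) c(2) cn by (subst card_Diff_subset) auto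
    then obtain e where e: "S - {y, a, b, c} = {e}" using card_1_singletonE by blast
    then have eS: "e \<in> S" "e \<notin> {y, a, b, c}" by auto
    have cc: "nbh E c S = {a, b}"
      by (rule card_subset_eq[symmetric]) (use finS abS cS dS eq two[OF cS(1)] ab(2) in \<open>auto simp: in_nbh_iff\<close>)
    have bwd: "e \<in> nbh E f S" if "E e f" for f
      using that eS(1) sym by (simp add: in_nbh_iff)
    have "\<not> E e y" "\<not> E e a" "\<not> E e b" "\<not> E e c"
      using bwd[of y] bwd[of a] bwd[of b] bwd[of c] ab(1) c(1) d(1) cc eS(2) eq by auto
    then have "nbh E e S \<subseteq> S - {y, a, b, c} - {e}"
      using irrefl by (auto simp: in_nbh_iff)
    then have "nbh E e S = {}" using e by auto
    then show False using two[OF eS(1)] by simp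
  qed
  have ncb: "\<not> E b c" "\<not> E a d"
    using c(1) d(1) cS dS cd c(2) d(2) by (auto simp: nbh_def set_eq_iff)
  have Pm: "y \<in> P" "a \<in> P" "b \<in> P" "c \<in> P" "d \<in> P" using y abS cS dS S(1) by auto
  have cdE: "E c d"
  proof -
    have Sall: "S = {y, a, b, c, d}"
      by (rule card_subset_eq[symmetric]) (use finS y abS cS dS yab ab(2) c(2) d(2) cn dn cd S(2) in auto)
    have "nbh E c S \<subseteq> {a, d}"
      unfolding Sall using cn ncb sym irrefl by (auto simp: in_nbh_iff)
    moreover have "card (nbh E c S) = 2" using two cS by blast
    ultimately have "nbh E c S = {a, d}"
      using dn(1) by (intro card_subset_eq) auto
    then show ?thesis by (auto simp: nbh_def set_eq_iff)
  qed
  \<comment> \<open>The second common neighbour \<open>z\<close> of \<open>a\<close> and \<open>b\<close> turns out to be adjacent to \<open>c\<close> and \<open>d\<close>, so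
    that the edge between \<open>c\<close> and \<open>z\<close> lies in two triangles.\<close>
  have "card (nbh E a (nbh E b P)) = 2" using common(2)[of b a] Pm nab ab(2) by auto
  moreover have "y \<in> nbh E a (nbh E b P)" using Pm abS by (simp add: in_nbh_iff)
  ultimately obtain z where z: "z \<in> nbh E a (nbh E b P)" "z \<noteq> y"
    by (metis card_2_iff insertCI)
  then have zP: "z \<in> P" "E b z" "E a z" "E z a" "E z b" using sym by (auto simp: in_nbh_iff)
  \<comment> \<open>The letters are generalized so that \<open>a\<close> and \<open>b\<close> can be
    exchanged. The neighbours of \<open>a\<close> are \<open>y\<close>, \<open>c\<close>,
    \<open>z\<close> and the apex \<open>s\<close> of the triangle on \<open>y\<close> and
    \<open>a\<close>. The apex \<open>t\<close> of the triangle on \<open>a\<close> and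
    \<open>c\<close> is one of them, and only \<open>z\<close> is possible: \<open>t = s\<close>
    would put the edge from \<open>a\<close> to \<open>s\<close> into two triangles.\<close>
  have third: "E c z"
    if h: "a \<in> P" "b \<in> P" "c \<in> P" "E y a" "E a y" "E y b" "E b y" "E a c" "E c a" "\<not> E y c" "\<not> E b c" "c \<noteq> y"
      "E a z" "E b z" "a \<noteq> b" for a b c
  proof -
    have D4: "card (nbh E a P) = 4" using free5_card9_regular(1)[OF fin card free h(1)] .
    have "card (nbh E y (nbh E a P)) = 1" using common(1)[of a y] h Pm by blast
    then obtain s where "nbh E y (nbh E a P) = {s}" using card_1_singletonE by blast
    then have "s \<in> nbh E y (nbh E a P)" by simp
    then have s: "s \<in> P" "E a s" "E y s" by (simp_all add: in_nbh_iff)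
    have zy: "\<not> E y z" using uniq[of y z a b] zP(1) h Pm z(2) sym by blast
    have dist: "card {y, s, c, z} = 4"
    proof -
      have "y \<noteq> s" "y \<noteq> c" "y \<noteq> z" using s(3) irrefl h z(2) by metis+
      moreover have "s \<noteq> c" "s \<noteq> z" "c \<noteq> z" using s(3) h zy by metis+
      ultimately show ?thesis by simp
    qed
    have N: "nbh E a P = {y, s, c, z}"
      by (rule card_subset_eq[symmetric]) (use fin D4 dist Pm(1) s(1,2) h(1,3,5,8,13) zP(1) in \<open>auto simp: in_nbh_iff\<close>)
    have "card (nbh E c (nbh E a P)) = 1" using common(1)[of a c] h by blast
    then obtain t where "nbh E c (nbh E a P) = {t}" using card_1_singletonE by blast
    then have "t \<in> nbh E c (nbh E a P)" by simp
    then have t: "t \<in> P" "E a t" "E c t" by (simp_all add: in_nbh_iff)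
    from t have "t \<in> nbh E a P" by (simp add: in_nbh_iff)
    then have "t \<in> {y, s, c, z}" unfolding N .
    moreover have "t \<noteq> y" using t h sym by blast
    moreover have "t \<noteq> c" using t irrefl by blast
    moreover have "t \<noteq> s"
    proof
      assume "t = s"
      then have "c = y" using uniq[of a s c y] s t h Pm sym by blast
      then show False using h by blast
    qed
    ultimately show ?thesis using t by blast
  qed
  have "E c z" using third[of a b c] Pm abS cS cn ncb c(2) zP ab(2) by blast
  moreover have "E d z" using third[of b a d] Pm abS dS dn ncb d(2) zP ab(2) by blast
  ultimately have "a = d" using uniq[of c z a d] Pm zP cS cdE sym by blast
  then show False using dn by blast
qed

lemma free6_card18_not_all_nine:
  assumes fin: "finite V" and card: "card V = 18" and free: "\<not> thr E 6 V"
    and nine: "\<And>u. u \<in> V \<Longrightarrow> card (nbh E u V) = 9"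
  shows False
proof -
  note f6 = free6_nbh[OF fin card free]
  note reg = free6_regular(2)[OF fin card free refl]
  have "V \<noteq> {}" using card by auto
  then obtain v where v: "v \<in> V" by blast
  let ?D = "nbh E v V" and ?F = "nbh (compl_rel E) v V"
  have finD: "finite ?D" and finF: "finite ?F" using fin by auto
  have cD: "card ?D = 9" and cF: "card ?F = 8" using nine[OF v] f6(3)[OF v] by auto
  have X: "(\<Sum>u\<in>?D. 5 + card (nbh E u ?F)) = (\<Sum>u\<in>?D. 9)"
  proof (rule sum.cong[OF refl])
    fix u assume u: "u \<in> ?D"
    then have "card (nbh E u ?D) = 4"
      using free5_card9_regular(1)[OF finD cD f6(1)[OF v]] by blast
    moreover have "u \<in> V" "E u v" using u sym by (auto simp: in_nbh_iff)
    ultimately show "5 + card (nbh E u ?F) = 9"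
      using card_nbh_decomp[OF fin v, of u] nine[of u] by simp
  qed
  then have "(\<Sum>w\<in>?F. card (nbh E w ?D)) = 36"
    using cD double_count[OF finD finF] by (simp add: sum.distrib)
  moreover have F: "card (nbh E w ?D) + card (nbh E w ?F) = 9 \<and> card (nbh E w ?F) \<ge> 4" if w: "w \<in> ?F" for w
  proof -
    have "w \<in> V" "\<not> E w v" using w sym by (auto simp: in_nbh_iff compl_rel_def)
    then have "card (nbh E w ?D) + card (nbh E w ?F) = 9"
      using card_nbh_decomp[OF fin v, of w] nine by simp
    moreover have "card (nbh (compl_rel E) w ?F) \<le> 3"
      using reg[OF _ v w] v nine by blast
    ultimately show ?thesis using card_nbh_compl[OF finF w] cF by linarith
  qed
  ultimately have "\<not> (\<forall>w\<in>?F. card (nbh E w ?D) \<le> 4)"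
    using sum_bounded_above[of ?F "\<lambda>w. card (nbh E w ?D)" 4] cF by auto
  \<comment> \<open>The eight vertices of \<open>?F\<close> receive 36 edges from \<open>?D\<close>,
    more than 4 on average, and none receives more than 5 since each has at least 4 neighbours
    inside \<open>?F\<close>.\<close>
  have "\<exists>x\<in>?F. card (nbh E x ?D) = 5"
  proof (rule ccontr)
    assume none: "\<not> ?thesis"
    have "card (nbh E w ?D) \<le> 4" if "w \<in> ?F" for w
    proof -
      have "card (nbh E w ?D) \<noteq> 5" using none that by blast
      then show ?thesis using F[OF that] by linarith
    qed
    then show False using \<open>\<not> (\<forall>w\<in>?F. card (nbh E w ?D) \<le> 4)\<close> by blast
  qed
  then obtain x where x: "x \<in> ?F" "card (nbh E x ?D) = 5" by blast
  let ?S = "nbh E x ?D"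
  have xV: "x \<in> V" "x \<noteq> v" "\<not> E x v" "\<not> E v x" using x(1) sym by (auto simp: in_nbh_iff compl_rel_def)
  have S: "u \<in> V \<and> E u v \<and> E u x" if "u \<in> ?S" for u
    using that sym by (auto simp: in_nbh_iff)
  have eq: "nbh E u ?S = nbh E x (nbh E v (nbh E u V))" for u
    by (auto simp: nbh_def)
  \<comment> \<open>Seen inside the neighbourhood of \<open>u\<close>, these are the common
    neighbours of the nonadjacent vertices \<open>v\<close> and \<open>x\<close>.\<close>
  have two: "card (nbh E u ?S) = 2" if u: "u \<in> ?S" for u
  proof -
    have "v \<in> nbh E u V" "x \<in> nbh E u V" "u \<in> V"
      using S[OF u] v xV(1) by (auto simp: in_nbh_iff)
    then show ?thesis
      unfolding eq
      using free5_card9_common(2)[of "nbh E u V" v x] nine f6(1) fin xV by auto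
  qed
  \<comment> \<open>Inside the neighbourhood of \<open>u\<close>, adjacent \<open>p\<close> and
    \<open>q\<close> have only one common neighbour, but \<open>v\<close> and \<open>x\<close> are
    two.\<close>
  have tri: "\<not> E p q" if u: "u \<in> ?S" and pq: "p \<in> nbh E u ?S" "q \<in> nbh E u ?S" for u p q
  proof
    assume adj: "E p q"
    have uV: "u \<in> V" "E u v" "E u x" using S[OF u] by auto
    have "p \<in> nbh E u V" "q \<in> nbh E u V" using pq by (auto simp: in_nbh_iff)
    then have "card (nbh E p (nbh E q (nbh E u V))) = 1"
      using free5_card9_common(1)[of "nbh E u V" q p] nine[OF uV(1)] f6(1)[OF uV(1)] fin adj by auto
    moreover have "v \<in> nbh E p (nbh E q (nbh E u V))" "x \<in> nbh E p (nbh E q (nbh E u V))"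
      using pq uV v xV sym by (auto simp: in_nbh_iff)
    ultimately show False using xV(2) by (metis card_1_singletonE singletonD)
  qed
  show False
    by (rule free5_card9_no_pentagon[OF finD cD f6(1)[OF v] nbh_subset x(2) two tri])
qed

text \<open>By \<open>free6_regular\<close>, either all vertices or none have degree 9. In the
  latter case all have degree 9 in the complement.\<close>

lemma thr_6_card18:
  assumes fin: "finite V" and card: "card V = 18"
  shows "thr E 6 V"
proof (rule ccontr)
  interpret C: graph_rel "compl_rel E" by (rule compl_graph_rel)
  assume free: "\<not> thr E 6 V"
  then have Cfree: "\<not> thr (compl_rel E) 6 V" by (simp add: thr_compl)
  show False
  proof (cases "{u \<in> V. card (nbh E u V) = 9} = {}")
    case True
    have "card (nbh (compl_rel E) u V) = 9" if "u \<in> V" for u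
      using free6_nbh(3,4)[OF fin card free that] True that by auto
    then show False using C.free6_card18_not_all_nine[OF fin card Cfree] by blast
  next
    case False
    then have "{u \<in> V. card (nbh E u V) = 9} = V"
      using free6_regular(1)[OF fin card free refl] by blast
    then show False using free6_card18_not_all_nine[OF fin card free] by blast
  qed
qed

section \<open>Doubling from order 6 upwards\<close>

lemma thr_Suc_double:
  assumes fin: "finite V" and bound: "\<And>S. finite S \<Longrightarrow> card S \<ge> n \<Longrightarrow> thr E s S"
  shows "card V \<ge> 2 * n \<Longrightarrow> n > 0 \<Longrightarrow> thr E (Suc s) V"
    and "card V \<ge> 2 * n - 1 \<Longrightarrow> even n \<Longrightarrow> n > 0 \<Longrightarrow> thr E (Suc s) V"
proof -
  have step: "thr E (Suc s) W" if "finite W" "v \<in> W" "n \<le> card (nbh E v W) \<or> n \<le> card (nbh (compl_rel E) v W)" for v W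
    using that bound[of "nbh E v W"] bound[of "nbh (compl_rel E) v W"] by auto
  {
    assume "card V \<ge> 2 * n" "n > 0"
    moreover from this obtain v where "v \<in> V" by fastforce
    ultimately show "thr E (Suc s) V"
      using step[OF fin, of v] card_nbh_compl[OF fin, of v] by linarith
  next
    assume V: "card V \<ge> 2 * n - 1" "even n" "n > 0"
    then obtain W where W: "W \<subseteq> V" "card W = 2 * n - 1" "finite W"
      using obtain_subset_with_card_n by metis
    have "\<exists>v\<in>W. card (nbh E v W) \<noteq> n - 1"
    proof (rule ccontr)
      assume "\<not> ?thesis"
      then have "(\<Sum>v\<in>W. card (nbh E v W)) = (2 * n - 1) * (n - 1)" using W(2) by simp
      then show False using even_degree_sum[OF W(3)] V by simp
    qed
    then obtain v where v: "v \<in> W" "card (nbh E v W) \<noteq> n - 1" by blast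
    then have "n \<le> card (nbh E v W) \<or> n \<le> card (nbh (compl_rel E) v W)"
      using card_nbh_compl[OF W(3) v(1)] W(2) V(3) by linarith
    then show "thr E (Suc s) V" using step[OF W(3) v(1)] W(1) thr_mono[of E "Suc s" W V] by blast
  }
qed

text \<open>Clearing the denominator 3 keeps the rounding in integers. From even to odd
  \<open>s\<close> the correction 2 doubles to 4 and the saved vertex takes off 3; from odd to even,
  1 doubles to 2. The base is \<open>54 = 3 * 18\<close>.\<close>

lemma thr_bound:
  assumes "finite V" "3 * card V \<ge> 13 * 2 ^ (s + 2) + (if even s then 2 else 1)"
  shows "thr E (s + 6) V"
  using assms
proof (induction s arbitrary: V)
  case 0
  then have "card V \<ge> 18" by simp
  then obtain W where "W \<subseteq> V" "card W = 18" "finite W" using obtain_subset_with_card_n by metis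
  then show ?case using thr_6_card18 thr_mono[of E 6 W V] by auto
next
  case (Suc s)
  define r :: nat where "r = (if even s then 2 else 1)"
  have "3 dvd 13 * 2 ^ (s + 2) + r"
    unfolding r_def by (rule three_dvd_bound)
  then obtain n where n: "13 * 2 ^ (s + 2) + r = 3 * n" by (elim dvdE)
  have n0: "n > 0" using n by (cases n) auto
  have IH: "thr E (s + 6) S" if "finite S" "card S \<ge> n" for S
    using Suc.IH[OF that(1)] that(2) n unfolding r_def by linarith
  show ?case
  proof (cases "even s")
    case True
    have "even (13 * 2 ^ (s + 2) + r)" using True unfolding r_def by simp
    then have "even (3 * n)" unfolding n .
    then have "even n" by simp
    moreover have "card V \<ge> 2 * n - 1" using Suc.prems(2) True n unfolding r_def by simp
    ultimately show ?thesis using thr_Suc_double(2)[OF Suc.prems(1) IH] n0 by simp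
  next
    case False
    have "card V \<ge> 2 * n" using Suc.prems(2) False n unfolding r_def by simp
    then show ?thesis using thr_Suc_double(1)[OF Suc.prems(1) IH] n0 by simp
  qed
qed

end

section \<open>From the recursion to induced subgraphs\<close>

lemma thr_imp_threshold_graph:
  assumes "graph_rel E" "finite V" "thr E k V" "k > 0"
  shows "\<exists>W\<subseteq>V. finite W \<and> card W = k \<and> threshold_graph \<lparr>pverts = W, parcs = {(u, v). E u v} \<inter> W \<times> W\<rparr>"
  using assms(2-4)
proof (induction k arbitrary: V)
  case (Suc k)
  interpret graph_rel E by fact
  from Suc.prems(2) obtain v where v: "v \<in> V" and
    or: "thr E k (nbh E v V) \<or> thr E k (nbh (compl_rel E) v V)" by auto
  show ?case
  \<comment> \<open>The recursion ends at the empty set but threshold graphs start from one vertex,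
    so order 1 is the true base case.\<close>
  proof (cases "k = 0")
    case True
    have "{(u, v). E u v} \<inter> {v} \<times> {v} = {}" using irrefl by auto
    then show ?thesis
      using True v threshold_graph.single[of v] by (intro exI[of _ "{v}"]) auto
  next
    case False
    from or show ?thesis
    proof
      assume "thr E k (nbh E v V)"
      then obtain W where W: "W \<subseteq> nbh E v V" "finite W" "card W = k"
        "threshold_graph \<lparr>pverts = W, parcs = {(u, v). E u v} \<inter> W \<times> W\<rparr>"
        using Suc.IH[of "nbh E v V"] False Suc.prems(1) by auto
      have "v \<notin> W" using W(1) irrefl by (auto simp: in_nbh_iff)
      moreover have "{(u, v). E u v} \<inter> insert v W \<times> insert v W
          = {(u, v). E u v} \<inter> W \<times> W \<union> {v} \<times> W \<union> W \<times> {v}"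
        using W(1) irrefl sym by (auto simp: nbh_def)
      ultimately have "threshold_graph \<lparr>pverts = insert v W,
          parcs = {(u, v). E u v} \<inter> insert v W \<times> insert v W\<rparr>"
        using threshold_graph.dominating[OF W(4), of v] by simp
      then show ?thesis
        using W(1-3) v \<open>v \<notin> W\<close> nbh_subset by (intro exI[of _ "insert v W"]) fastforce
    next
      assume "thr E k (nbh (compl_rel E) v V)"
      then obtain W where W: "W \<subseteq> nbh (compl_rel E) v V" "finite W" "card W = k"
        "threshold_graph \<lparr>pverts = W, parcs = {(u, v). E u v} \<inter> W \<times> W\<rparr>"
        using Suc.IH[of "nbh (compl_rel E) v V"] False Suc.prems(1) by auto
      have "v \<notin> W" using W(1) by (auto simp: in_nbh_iff compl_rel_def)
      moreover have "{(u, v). E u v} \<inter> insert v W \<times> insert v W = {(u, v). E u v} \<inter> W \<times> W"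
        using W(1) irrefl sym by (auto simp: nbh_def compl_rel_def)
      ultimately have "threshold_graph \<lparr>pverts = insert v W,
          parcs = {(u, v). E u v} \<inter> insert v W \<times> insert v W\<rparr>"
        using threshold_graph.isolated[OF W(4), of v] by simp
      then show ?thesis
        using W(1-3) v \<open>v \<notin> W\<close> nbh_subset by (intro exI[of _ "insert v W"]) fastforce
    qed
  qed
qed simp

lemma thr_imp_has_induced_threshold:
  assumes "pair_graph G" "thr (\<lambda>u v. (u, v) \<in> parcs G) s (pverts G)" "s > 0"
  shows "has_induced_threshold s G"
proof -
  interpret pair_graph G by fact
  have "graph_rel (\<lambda>u v. (u, v) \<in> parcs G)"
    using pair_sym_arcs by unfold_locales (auto simp: symmetric_def sym_def dest: pair_no_loops)
  from thr_imp_threshold_graph[OF this pair_finite_verts assms(2,3)]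
  obtain W where W: "W \<subseteq> pverts G" "card W = s"
    "threshold_graph \<lparr>pverts = W, parcs = parcs G \<inter> W \<times> W\<rparr>" by auto
  let ?H = "\<lparr>pverts = W, parcs = parcs G \<inter> W \<times> W\<rparr>"
  have "pair_graph ?H" using threshold_graph_pair_graph(1)[OF W(3)] .
  then have "wf_digraph (with_proj ?H)"
    unfolding wf_digraph_wp_iff pair_graph_def pair_digraph_def pair_fin_digraph_def by blast
  then have "induced_subgraph (with_proj ?H) (with_proj G)"
    using W(1) wf_digraph by (auto simp: induced_subgraph_def subgraph_def compatible_def)
  then show ?thesis using W unfolding has_induced_threshold_def by auto
qed

theorem corollary3p12:
  fixes s :: nat
  assumes "s \<ge> 6"
  shows "int (r2' s) \<le> \<lceil>(13 / 48 :: real) * 2 ^ s\<rceil>"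
proof -
  obtain t where t: "s = t + 6" using assms by (metis add.commute le_iff_add)
  define r :: nat where "r = (if even t then 2 else 1)"
  have "3 dvd 13 * 2 ^ (t + 2) + r"
    unfolding r_def by (rule three_dvd_bound)
  then obtain n where n: "13 * 2 ^ (t + 2) + r = 3 * n" by (elim dvdE)
  have "has_induced_threshold s G" if G: "pair_graph G" "card (pverts G) = n" for G :: "nat pair_pre_digraph"
  proof -
    interpret pair_graph G by fact
    interpret graph_rel "\<lambda>u v. (u, v) \<in> parcs G"
      using pair_sym_arcs by unfold_locales (auto simp: symmetric_def sym_def dest: pair_no_loops)
    have "thr (\<lambda>u v. (u, v) \<in> parcs G) s (pverts G)"
      using thr_bound[OF pair_finite_verts, of t] n G(2) t unfolding r_def by simp
    then show ?thesis using thr_imp_has_induced_threshold[OF G(1)] assms by simp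
  qed
  then have "r2' s \<le> n" unfolding r2'_def by (intro Least_le) blast
  \<comment> \<open>The integer \<open>n\<close> exceeds the real value by \<open>r / 3\<close>,
    which is less than 1.\<close>
  moreover have "\<lceil>(13 / 48 :: real) * 2 ^ s\<rceil> = int n"
  proof -
    have "real (13 * 2 ^ (t + 2) + r) = real (3 * n)" using n by simp
    then have "(13 / 48 :: real) * 2 ^ s = real n - real r / 3"
      unfolding t by (simp add: power_add field_simps)
    then show ?thesis unfolding r_def by (auto intro!: ceiling_unique)
  qed
  ultimately show ?thesis by simp
qed

end
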